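(* Let $X$ be a Tychonoff space. The set of all maximal ideals of the ring $B_1(X)$ is exactly $\{\widehat{M^p}: p\in\widetilde{X}\}$, where $\widehat{M^p}=\{f\in B_1(X): p\in \mathrm{cl}_{\widetilde{X}}Z(f)\}$. Further, if $p\neq q$ in $\widetilde{X}$ then $\widehat{M^p}\neq\widehat{M^q}$.
   Context: $B_1(X)$ is the ring of Baire one functions on $X$, i.e. pointwise limits of sequences of continuous functions $X\to\mathbb{R}$. For $f\in B_1(X)$, $Z(f)=\{x\in X: f(x)=0\}$, and $Z(B_1(X))=\{Z(f): f\in B_1(X)\}$. A $Z_B$-filter on $X$ is a nonempty family $\mathscr{F}\subseteq Z(B_1(X))$ with $\emptyset\notin\mathscr{F}$, closed under finite intersections, and such that $Z\in\mathscr{F}$, $Z'\in Z(B_1(X))$, $Z\subseteq Z'$ imply $Z'\in\mathscr{F}$. A $Z_B$-ultrafilter is a $Z_B$-filter that is maximal under inclusion. For $p\in X$, $\mathscr{U}_p=\{Z\in Z(B_1(X)): p\in Z\}$ is a $Z_B$-ultrafilter. The set $\widetilde{X}\supseteq X$ is an index set for the family of all $Z_B$-ultrafilters on $X$: $p\mapsto\mathscr{U}^p$ is a bijection from $\widetilde{X}$ onto the set of all $Z_B$-ultrafilters on $X$, with $\mathscr{U}^p=\mathscr{U}_p$ for $p\in X$. For $Z\in Z(B_1(X))$, $\overline{Z}=\{p\in\widetilde{X}: Z\in\mathscr{U}^p\}$. The space $\widetilde{X}$ carries the Stone-topology, which has $\{\overline{Z}: Z\in Z(B_1(X))\}$ as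 a base for closed sets; $\mathrm{cl}_{\widetilde{X}}$ denotes closure in this topology. *)

theory Defs
  imports "HOL-Analysis.Analysis" "HOL-Algebra.Ideal"
begin

definition baire_one :: "'a topology \<Rightarrow> ('a \<Rightarrow> real) \<Rightarrow> bool" where
  "baire_one X f \<longleftrightarrow>
     (\<exists>F :: nat \<Rightarrow> 'a \<Rightarrow> real. (\<forall>n. continuous_map X euclideanreal (F n)) \<and>
        (\<forall>x\<in>topspace X. (\<lambda>n. F n x) \<longlonglongrightarrow> f x))"

(* A function on the set "topspace X" is represented by its unique extension that is
   undefined outside, so that equality in the ring is equality of functions on the space. *)
definition B1 :: "'a topology \<Rightarrow> ('a \<Rightarrow> real) set" where
  "B1 X = {f \<in> extensional (topspace X). baire_one X f}"

definition B1_ring :: "'a topology \<Rightarrow> ('a \<Rightarrow> real) ring" where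
  "B1_ring X =
     \<lparr>carrier = B1 X,
      monoid.mult = (\<lambda>f g. \<lambda>x\<in>topspace X. f x * g x),
      one = (\<lambda>x\<in>topspace X. 1),
      zero = (\<lambda>x\<in>topspace X. 0),
      add = (\<lambda>f g. \<lambda>x\<in>topspace X. f x + g x)\<rparr>"

definition zero_set :: "'a topology \<Rightarrow> ('a \<Rightarrow> real) \<Rightarrow> 'a set" where
  "zero_set X f = {x \<in> topspace X. f x = 0}"

definition B1_zero_sets :: "'a topology \<Rightarrow> 'a set set" where
  "B1_zero_sets X = zero_set X ` B1 X"

definition ZB_filter :: "'a topology \<Rightarrow> 'a set set \<Rightarrow> bool" where
  "ZB_filter X \<F> \<longleftrightarrow>
     \<F> \<noteq> {} \<and> \<F> \<subseteq> B1_zero_sets X \<and> {} \<notin> \<F> \<and>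
     (\<forall>Z\<in>\<F>. \<forall>Z'\<in>\<F>. Z \<inter> Z' \<in> \<F>) \<and>
     (\<forall>Z\<in>\<F>. \<forall>Z'\<in>B1_zero_sets X. Z \<subseteq> Z' \<longrightarrow> Z' \<in> \<F>)"

definition ZB_ultrafilter :: "'a topology \<Rightarrow> 'a set set \<Rightarrow> bool" where
  "ZB_ultrafilter X \<F> \<longleftrightarrow>
     ZB_filter X \<F> \<and> (\<forall>\<G>. ZB_filter X \<G> \<and> \<F> \<subseteq> \<G> \<longrightarrow> \<G> = \<F>)"

definition ZB_point :: "'a topology \<Rightarrow> 'a \<Rightarrow> 'a set set" where
  "ZB_point X p = {Z \<in> B1_zero_sets X. p \<in> Z}"

(* Xt is an index set for all ZB-ultrafilters, containing the points of X through the
   injection \<iota>; the literal reading "X is a subset of Xt" is the case \<iota> = id. An injection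
   is used because the type 'a may be too small to contain such an Xt. *)
definition ZB_index ::
  "'a topology \<Rightarrow> 'b set \<Rightarrow> ('a \<Rightarrow> 'b) \<Rightarrow> ('b \<Rightarrow> 'a set set) \<Rightarrow> bool" where
  "ZB_index X Xt \<iota> U \<longleftrightarrow>
     \<iota> ` topspace X \<subseteq> Xt \<and> inj_on \<iota> (topspace X) \<and>
     bij_betw U Xt {\<F>. ZB_ultrafilter X \<F>} \<and>
     (\<forall>p\<in>topspace X. U (\<iota> p) = ZB_point X p)"

definition ZB_bar :: "'b set \<Rightarrow> ('b \<Rightarrow> 'a set set) \<Rightarrow> 'a set \<Rightarrow> 'b set" where
  "ZB_bar Xt U Z = {p \<in> Xt. Z \<in> U p}"

(* The sets "ZB_bar Xt U Z" are a base for the closed sets, i.e. their complements are a base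
   for the open sets; see stone_topology_closedin below. *)
definition stone_topology ::
  "'a topology \<Rightarrow> 'b set \<Rightarrow> ('b \<Rightarrow> 'a set set) \<Rightarrow> 'b topology" where
  "stone_topology X Xt U =
     topology (arbitrary union_of (\<lambda>S. \<exists>Z\<in>B1_zero_sets X. S = Xt - ZB_bar Xt U Z))"

definition M_hat ::
  "'a topology \<Rightarrow> 'b set \<Rightarrow> ('a \<Rightarrow> 'b) \<Rightarrow> ('b \<Rightarrow> 'a set set) \<Rightarrow> 'b \<Rightarrow> ('a \<Rightarrow> real) set" where
  "M_hat X Xt \<iota> U p =
     {f \<in> B1 X. p \<in> (stone_topology X Xt U) closure_of (\<iota> ` zero_set X f)}"

lemma baire_one_const: "baire_one X (\<lambda>x. c)"
  unfolding baire_one_def by (rule exI[of _ "\<lambda>n x. c"]) auto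

lemma baire_one_add: "baire_one X f \<Longrightarrow> baire_one X g \<Longrightarrow> baire_one X (\<lambda>x. f x + g x)"
  unfolding baire_one_def
  apply clarify
  subgoal for F G
    by (rule exI[of _ "\<lambda>n x. F n x + G n x"]) (auto intro: continuous_map_add tendsto_add)
  done

lemma baire_one_mult: "baire_one X f \<Longrightarrow> baire_one X g \<Longrightarrow> baire_one X (\<lambda>x. f x * g x)"
  unfolding baire_one_def
  apply clarify
  subgoal for F G
    by (rule exI[of _ "\<lambda>n x. F n x * G n x"]) (auto intro: continuous_map_real_mult tendsto_mult)
  done

lemma zero_set_in:
  assumes "baire_one X f" shows "zero_set X f \<in> B1_zero_sets X"
proof -
  have "restrict f (topspace X) \<in> B1 X"
    using assms by (auto simp: B1_def baire_one_def)
  moreover have "zero_set X f = zero_set X (restrict f (topspace X))"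
    by (auto simp: zero_set_def)
  ultimately show ?thesis
    unfolding B1_zero_sets_def by blast
qed

lemma B1_zero_setsE:
  assumes "Z \<in> B1_zero_sets X"
  obtains f where "baire_one X f" "Z = zero_set X f"
  using assms by (auto simp: B1_zero_sets_def B1_def)

lemma B1_zero_sets_Un:
  assumes "Z \<in> B1_zero_sets X" "Z' \<in> B1_zero_sets X"
  shows "Z \<union> Z' \<in> B1_zero_sets X"
proof -
  obtain f g where fg: "baire_one X f" "Z = zero_set X f" "baire_one X g" "Z' = zero_set X g"
    using assms by (metis B1_zero_setsE)
  have "Z \<union> Z' = zero_set X (\<lambda>x. f x * g x)"
    by (auto simp: fg zero_set_def)
  then show ?thesis
    using zero_set_in[OF baire_one_mult[OF fg(1,3)]] by simp
qed

lemma B1_zero_sets_Int: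
  assumes "Z \<in> B1_zero_sets X" "Z' \<in> B1_zero_sets X"
  shows "Z \<inter> Z' \<in> B1_zero_sets X"
proof -
  obtain f g where fg: "baire_one X f" "Z = zero_set X f" "baire_one X g" "Z' = zero_set X g"
    using assms by (metis B1_zero_setsE)
  have "Z \<inter> Z' = zero_set X (\<lambda>x. f x * f x + g x * g x)"
    by (auto simp: fg zero_set_def)
  then show ?thesis
    using zero_set_in[OF baire_one_add[OF baire_one_mult[OF fg(1,1)] baire_one_mult[OF fg(3,3)]]]
    by simp
qed

lemma empty_B1_zero_set: "{} \<in> B1_zero_sets X"
proof -
  have "{} = zero_set X (\<lambda>x. 1)"
    by (auto simp: zero_set_def)
  then show ?thesis
    using zero_set_in[OF baire_one_const[of X 1]] by simp
qed

lemma ZB_ultrafilter_meets: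
  assumes U: "ZB_ultrafilter X \<F>" and Z: "Z \<in> B1_zero_sets X" and nZ: "Z \<notin> \<F>"
  obtains W where "W \<in> \<F>" "W \<inter> Z = {}"
proof (rule ccontr)
  assume "\<not> thesis"
  then have ne: "\<And>W. W \<in> \<F> \<Longrightarrow> W \<inter> Z \<noteq> {}"
    using that by blast
  have F: "ZB_filter X \<F>"
    using U by (simp add: ZB_ultrafilter_def)
  define \<G> where "\<G> = {Y \<in> B1_zero_sets X. \<exists>W\<in>\<F>. W \<inter> Z \<subseteq> Y}"
  have sub: "\<F> \<subseteq> \<G>" and ZG: "Z \<in> \<G>"
    using F Z by (auto simp: \<G>_def ZB_filter_def)
  have int: "A \<inter> B \<in> \<G>" if A: "A \<in> \<G>" and B: "B \<in> \<G>" for A B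
  proof -
    obtain V W where "V \<in> \<F>" "V \<inter> Z \<subseteq> A" "W \<in> \<F>" "W \<inter> Z \<subseteq> B"
      using A B by (auto simp: \<G>_def)
    then have "V \<inter> W \<in> \<F>" "(V \<inter> W) \<inter> Z \<subseteq> A \<inter> B"
      using F by (auto simp: ZB_filter_def)
    then show ?thesis
      using A B B1_zero_sets_Int unfolding \<G>_def by blast
  qed
  have up: "B \<in> \<G>" if "A \<in> \<G>" "B \<in> B1_zero_sets X" "A \<subseteq> B" for A B
    using that unfolding \<G>_def by blast
  have "{} \<notin> \<G>" "\<G> \<subseteq> B1_zero_sets X" "\<G> \<noteq> {}"
    using ne ZG by (auto simp: \<G>_def)
  with int up have "ZB_filter X \<G>"
    unfolding ZB_filter_def by blast
  then have "\<G> = \<F>"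
    using U sub by (auto simp: ZB_ultrafilter_def)
  then show False
    using ZG nZ by simp
qed

lemma ZB_ultrafilter_Un_iff:
  assumes U: "ZB_ultrafilter X \<F>" and Z: "Z \<in> B1_zero_sets X" "Z' \<in> B1_zero_sets X"
  shows "Z \<union> Z' \<in> \<F> \<longleftrightarrow> Z \<in> \<F> \<or> Z' \<in> \<F>"
proof -
  have F: "ZB_filter X \<F>"
    using U by (simp add: ZB_ultrafilter_def)
  have False if un: "Z \<union> Z' \<in> \<F>" and n: "Z \<notin> \<F>" "Z' \<notin> \<F>"
  proof -
    obtain V W where VW: "V \<in> \<F>" "V \<inter> Z = {}" "W \<in> \<F>" "W \<inter> Z' = {}"
      using ZB_ultrafilter_meets[OF U] Z n by metis
    then have "(V \<inter> W) \<inter> (Z \<union> Z') \<in> \<F>"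
      using F un unfolding ZB_filter_def by blast
    moreover have "(V \<inter> W) \<inter> (Z \<union> Z') = {}"
      using VW by blast
    ultimately show False
      using F by (simp add: ZB_filter_def)
  qed
  moreover have "Z \<union> Z' \<in> \<F>" if "Z \<in> \<F> \<or> Z' \<in> \<F>"
    using that F B1_zero_sets_Un[OF Z] unfolding ZB_filter_def by blast
  ultimately show ?thesis
    by blast
qed

lemma ZB_index_ultrafilter: "ZB_index X Xt \<iota> U \<Longrightarrow> p \<in> Xt \<Longrightarrow> ZB_ultrafilter X (U p)"
  by (auto simp: ZB_index_def bij_betw_def)

lemma openin_stone_topology:
  assumes "ZB_index X Xt \<iota> U"
  shows "openin (stone_topology X Xt U) =
           arbitrary union_of (\<lambda>S. \<exists>Z\<in>B1_zero_sets X. S = Xt - ZB_bar Xt U Z)"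
proof -
  have *: "(Xt - ZB_bar Xt U Z) \<inter> (Xt - ZB_bar Xt U Z') = Xt - ZB_bar Xt U (Z \<union> Z')"
    if "Z \<in> B1_zero_sets X" "Z' \<in> B1_zero_sets X" for Z Z'
    using ZB_ultrafilter_Un_iff[OF ZB_index_ultrafilter[OF assms]] that
    by (auto simp: ZB_bar_def)
  show ?thesis
    unfolding stone_topology_def
  proof (intro topology_inverse' istopology_base)
    fix S T
    assume "\<exists>Z\<in>B1_zero_sets X. S = Xt - ZB_bar Xt U Z"
      and "\<exists>Z\<in>B1_zero_sets X. T = Xt - ZB_bar Xt U Z"
    then obtain Z Z' where Z: "Z \<in> B1_zero_sets X" "S = Xt - ZB_bar Xt U Z"
        and Z': "Z' \<in> B1_zero_sets X" "T = Xt - ZB_bar Xt U Z'"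
      by blast
    have "S \<inter> T = Xt - ZB_bar Xt U (Z \<union> Z')"
      using *[OF Z(1) Z'(1)] Z(2) Z'(2) by simp
    then show "\<exists>Z\<in>B1_zero_sets X. S \<inter> T = Xt - ZB_bar Xt U Z"
      using B1_zero_sets_Un[OF Z(1) Z'(1)] by blast
  qed
qed

lemma topspace_stone_topology:
  assumes "ZB_index X Xt \<iota> U"
  shows "topspace (stone_topology X Xt U) = Xt"
proof -
  have "ZB_bar Xt U {} = {}"
    using ZB_index_ultrafilter[OF assms]
    by (auto simp: ZB_bar_def ZB_ultrafilter_def ZB_filter_def)
  then have "openin (stone_topology X Xt U) Xt"
    unfolding openin_stone_topology[OF assms]
    by (intro arbitrary_union_of_inc bexI[OF _ empty_B1_zero_set]) auto
  moreover have "S \<subseteq> Xt" if "openin (stone_topology X Xt U) S" for S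
    using that unfolding openin_stone_topology[OF assms] union_of_def arbitrary_def by auto
  ultimately show ?thesis
    by (metis openin_subset openin_topspace subset_antisym)
qed

lemma stone_topology_closedin:
  assumes "ZB_index X Xt \<iota> U"
  shows "closedin (stone_topology X Xt U) C \<longleftrightarrow>
           (\<exists>\<Z> \<subseteq> B1_zero_sets X. C = Xt \<inter> (\<Inter>Z\<in>\<Z>. ZB_bar Xt U Z))"
proof
  assume "closedin (stone_topology X Xt U) C"
  then have C: "C \<subseteq> Xt" and "openin (stone_topology X Xt U) (Xt - C)"
    by (auto simp: closedin_def topspace_stone_topology[OF assms])
  then have "(arbitrary union_of (\<lambda>S. \<exists>Z\<in>B1_zero_sets X. S = Xt - ZB_bar Xt U Z)) (Xt - C)"
    by (simp only: openin_stone_topology[OF assms])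
  then obtain \<V> where V: "\<V> \<subseteq> {S. \<exists>Z\<in>B1_zero_sets X. S = Xt - ZB_bar Xt U Z}"
      and un: "\<Union>\<V> = Xt - C"
    unfolding union_of_def by (elim exE conjE) (rule that)
  define \<Z> where "\<Z> = {Z \<in> B1_zero_sets X. Xt - ZB_bar Xt U Z \<in> \<V>}"
  have "\<V> = (\<lambda>Z. Xt - ZB_bar Xt U Z) ` \<Z>"
    using V by (auto simp: \<Z>_def)
  then have "Xt - C = (\<Union>Z\<in>\<Z>. Xt - ZB_bar Xt U Z)"
    using un by simp
  then have "C = Xt \<inter> (\<Inter>Z\<in>\<Z>. ZB_bar Xt U Z)"
    using C by (auto simp: set_eq_iff)
  then show "\<exists>\<Z> \<subseteq> B1_zero_sets X. C = Xt \<inter> (\<Inter>Z\<in>\<Z>. ZB_bar Xt U Z)"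
    unfolding \<Z>_def by blast
next
  assume "\<exists>\<Z> \<subseteq> B1_zero_sets X. C = Xt \<inter> (\<Inter>Z\<in>\<Z>. ZB_bar Xt U Z)"
  then obtain \<Z> where Z: "\<Z> \<subseteq> B1_zero_sets X" "C = Xt \<inter> (\<Inter>Z\<in>\<Z>. ZB_bar Xt U Z)"
    by blast
  have "openin (stone_topology X Xt U) (Xt - ZB_bar Xt U Z)" if "Z \<in> \<Z>" for Z
    unfolding openin_stone_topology[OF assms]
    using that Z by (intro arbitrary_union_of_inc) blast
  then have "openin (stone_topology X Xt U) (\<Union>Z\<in>\<Z>. Xt - ZB_bar Xt U Z)"
    by blast
  moreover have "(\<Union>Z\<in>\<Z>. Xt - ZB_bar Xt U Z) = Xt - C"
    using Z by blast
  ultimately show "closedin (stone_topology X Xt U) C"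
    using Z by (simp add: closedin_def topspace_stone_topology[OF assms])
qed

lemma ZB_point_ultrafilter:
  assumes p: "p \<in> topspace X"
  shows "ZB_ultrafilter X (ZB_point X p)"
proof -
  have "topspace X = zero_set X (\<lambda>x. 0)"
    by (auto simp: zero_set_def)
  then have top: "topspace X \<in> ZB_point X p"
    using p zero_set_in[OF baire_one_const[of X 0]] by (simp add: ZB_point_def)
  have F: "ZB_filter X (ZB_point X p)"
    using top B1_zero_sets_Int unfolding ZB_filter_def ZB_point_def by blast
  moreover have "\<G> = ZB_point X p" if G: "ZB_filter X \<G>" and sub: "ZB_point X p \<subseteq> \<G>" for \<G>
  proof -
    have "p \<in> Z" if ZG: "Z \<in> \<G>" for Z
    proof (rule ccontr)
      assume "p \<notin> Z"
      obtain f where f: "baire_one X f" "Z = zero_set X f"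
        using ZG G by (meson B1_zero_setsE ZB_filter_def subsetD)
      define W where "W = zero_set X (\<lambda>x. f x + - f p)"
      have "p \<in> W"
        using p by (simp add: W_def zero_set_def)
      moreover have "W \<in> B1_zero_sets X"
        unfolding W_def by (intro zero_set_in baire_one_add baire_one_const f)
      ultimately have "W \<in> ZB_point X p"
        by (simp add: ZB_point_def)
      then have "W \<inter> Z \<in> \<G>"
        using G sub ZG unfolding ZB_filter_def by blast
      moreover have "W \<inter> Z = {}"
        using \<open>p \<notin> Z\<close> p by (auto simp: f W_def zero_set_def)
      ultimately show False
        using G by (simp add: ZB_filter_def)
    qed
    then show ?thesis
      using G sub unfolding ZB_filter_def ZB_point_def by blast
  qed
  ultimately show ?thesis
    unfolding ZB_ultrafilter_def by blast
qed

lemma inj_on_ZB_point: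
  assumes "completely_regular_space X" "Hausdorff_space X"
  shows "inj_on (ZB_point X) (topspace X)"
proof (rule inj_onI, rule ccontr)
  fix p q
  assume pq: "p \<in> topspace X" "q \<in> topspace X" "ZB_point X p = ZB_point X q" "p \<noteq> q"
  have "closedin X {q}"
    using assms(2) pq(2) by (simp add: closedin_Hausdorff_sing_eq)
  moreover have "p \<in> topspace X - {q}"
    using pq by simp
  ultimately obtain f :: "'a \<Rightarrow> real"
    where f: "continuous_map X (top_of_set {0..1}) f" "f p = 0" "f q = 1"
    using assms(1) unfolding completely_regular_space_def
    by (metis image_empty image_insert insert_subset singletonD)
  then have "baire_one X f"
    unfolding baire_one_def
    by (intro exI[of _ "\<lambda>n. f"]) (auto simp: continuous_map_in_subtopology)
  then have "zero_set X f \<in> B1_zero_sets X"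
    by (rule zero_set_in)
  moreover have "p \<in> zero_set X f"
    using f pq by (simp add: zero_set_def)
  ultimately have "zero_set X f \<in> ZB_point X q"
    unfolding pq(3)[symmetric] by (simp add: ZB_point_def)
  then have "q \<in> zero_set X f"
    by (simp add: ZB_point_def)
  then show False
    using f by (simp add: zero_set_def)
qed

(* The hypothesis "ZB_index" is satisfiable: index each ultrafilter by itself. *)
lemma ZB_index_exists:
  assumes "completely_regular_space X" "Hausdorff_space X"
  shows "ZB_index X {\<F>. ZB_ultrafilter X \<F>} (ZB_point X) id"
  using inj_on_ZB_point[OF assms] ZB_point_ultrafilter[of _ X] by (auto simp: ZB_index_def)

end

theory Submission
  imports Defs
begin

text \<open>
  The theorem is the dictionary between ideals of the ring and filters of zero sets, in the form
  that Gelfand and Kolmogorov gave it for rings of continuous functions.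

  The Stone topology enters only once: in it the closure of (the copy of) a zero set
  \<open>Z\<close> is the basic closed set \<open>ZB_bar Xt U Z\<close>, because a basic closed set that contains \<open>Z\<close> comes
  from a zero set that contains \<open>Z\<close> (\<open>stone_closure_of_zero_set\<close>). So \<open>M_hat\<close> at \<open>p\<close> consists of
  the functions whose zero set belongs to the ultrafilter \<open>U p\<close>, and it remains to see that
  \<open>\<F> \<mapsto> {f. zero_set X f \<in> \<F>}\<close> is a bijection from ultrafilters to maximal ideals.

  Two facts make the dictionary work. A Baire one function without zeros is a unit
  (\<open>baire_one_inverse\<close>), so the zero sets of a proper ideal are nonempty; and the zero set of
  \<open>f\<^sup>2 + g\<^sup>2\<close> is the intersection of the zero sets of \<open>f\<close> and \<open>g\<close>, so these zero sets form a filter.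
  Filters thus yield proper ideals and proper ideals yield filters, in a monotone way, and
  maximality on one side is transported to the other. An ultrafilter contains a set disjoint from
  any zero set outside it, so enlarging its ideal by any further function produces a unit
  (\<open>maximalideal_zero_ideal\<close>). Conversely, a filter larger than the zero sets of a maximal ideal
  would give a proper ideal larger than that ideal (\<open>ZB_ultrafilter_zero_sets_of_maximalideal\<close>).
  Injectivity holds because a filter can be read off from its ideal.
\<close>

section \<open>Reciprocals of Baire one functions\<close>

text \<open>
  The reciprocals of continuous approximations \<open>F n\<close> need not be defined. The functions
  \<open>F n / ((F n)\<^sup>2 + 1 / (n + 1))\<close> are continuous everywhere and converge to \<open>f / f\<^sup>2\<close>.
\<close>

lemma baire_one_inverse:
  assumes "baire_one X f" and nz: "\<And>x. x \<in> topspace X \<Longrightarrow> f x \<noteq> 0"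
  shows "baire_one X (\<lambda>x. inverse (f x))"
proof -
  obtain F :: "nat \<Rightarrow> 'a \<Rightarrow> real"
    where cont: "\<And>n. continuous_map X euclideanreal (F n)"
      and lim: "\<And>x. x \<in> topspace X \<Longrightarrow> (\<lambda>n. F n x) \<longlonglongrightarrow> f x"
    using assms(1) unfolding baire_one_def by blast
  define G where "G n x = F n x / (F n x * F n x + inverse (real (Suc n)))" for n x
  have pos: "F n x * F n x + inverse (real (Suc n)) > 0" for n x
    by (intro add_nonneg_pos) auto
  have "continuous_map X euclideanreal (G n)" for n
    unfolding G_def
    by (intro continuous_map_real_divide continuous_map_add continuous_map_real_mult cont)
       (use pos[of n] in \<open>auto simp: less_imp_neq[symmetric]\<close>)
  moreover have "(\<lambda>n. G n x) \<longlonglongrightarrow> inverse (f x)" if x: "x \<in> topspace X" for x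
  proof -
    have "(\<lambda>n. G n x) \<longlonglongrightarrow> f x / (f x * f x + 0)"
      unfolding G_def using nz[OF x]
      by (intro tendsto_divide tendsto_add tendsto_mult lim[OF x] LIMSEQ_inverse_real_of_nat) auto
    then show ?thesis
      using nz[OF x] by (simp add: field_simps)
  qed
  ultimately show ?thesis
    unfolding baire_one_def by blast
qed

section \<open>The ring of Baire one functions\<close>

lemma restrict_in_B1: "baire_one X f \<Longrightarrow> restrict f (topspace X) \<in> B1 X"
  by (auto simp: B1_def baire_one_def)

lemma B1_baire_one: "f \<in> B1 X \<Longrightarrow> baire_one X f"
  by (simp add: B1_def)

lemma B1_undefined: "f \<in> B1 X \<Longrightarrow> x \<notin> topspace X \<Longrightarrow> f x = undefined"
  by (auto simp: B1_def extensional_def)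

lemma B1_ring_simps [simp]:
  "carrier (B1_ring X) = B1 X"
  "f \<otimes>\<^bsub>B1_ring X\<^esub> g = (\<lambda>x\<in>topspace X. f x * g x)"
  "f \<oplus>\<^bsub>B1_ring X\<^esub> g = (\<lambda>x\<in>topspace X. f x + g x)"
  "\<one>\<^bsub>B1_ring X\<^esub> = (\<lambda>x\<in>topspace X. 1)"
  "\<zero>\<^bsub>B1_ring X\<^esub> = (\<lambda>x\<in>topspace X. 0)"
  by (simp_all add: B1_ring_def)

lemma B1_const: "(\<lambda>x\<in>topspace X. c) \<in> B1 X"
  by (rule restrict_in_B1[OF baire_one_const])

lemma B1_add: "f \<in> B1 X \<Longrightarrow> g \<in> B1 X \<Longrightarrow> (\<lambda>x\<in>topspace X. f x + g x) \<in> B1 X"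
  by (intro restrict_in_B1 baire_one_add B1_baire_one)

lemma B1_mult: "f \<in> B1 X \<Longrightarrow> g \<in> B1 X \<Longrightarrow> (\<lambda>x\<in>topspace X. f x * g x) \<in> B1 X"
  by (intro restrict_in_B1 baire_one_mult B1_baire_one)

lemma cring_B1_ring: "cring (B1_ring X)"
proof (rule cringI)
  show "abelian_group (B1_ring X)"
  proof (rule abelian_groupI)
    fix f
    assume f: "f \<in> carrier (B1_ring X)"
    have "(\<lambda>x\<in>topspace X. (\<lambda>x\<in>topspace X. -1) x * f x) \<in> B1 X"
      using f by (intro B1_mult B1_const) simp
    then show "\<exists>g\<in>carrier (B1_ring X). g \<oplus>\<^bsub>B1_ring X\<^esub> f = \<zero>\<^bsub>B1_ring X\<^esub>"
      by (intro bexI) (auto intro: restrict_ext)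
  qed (auto simp: fun_eq_iff B1_undefined B1_const B1_add)
  show "comm_monoid (B1_ring X)"
    by (rule comm_monoidI) (auto simp: fun_eq_iff B1_undefined B1_const B1_mult)
  fix f g h
  show "(f \<oplus>\<^bsub>B1_ring X\<^esub> g) \<otimes>\<^bsub>B1_ring X\<^esub> h = f \<otimes>\<^bsub>B1_ring X\<^esub> h \<oplus>\<^bsub>B1_ring X\<^esub> g \<otimes>\<^bsub>B1_ring X\<^esub> h"
    by (simp add: fun_eq_iff distrib_right)
qed

lemma ring_B1_ring: "ring (B1_ring X)"
  using cring_B1_ring by (rule cring.axioms)

section \<open>Zero sets and ideals\<close>

lemma zero_set_mult: "zero_set X (f \<otimes>\<^bsub>B1_ring X\<^esub> g) = zero_set X f \<union> zero_set X g"
  by (auto simp: zero_set_def)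

text \<open>Sums of squares turn intersections of zero sets into a ring operation.\<close>

lemma zero_set_sum_squares:
  "zero_set X (f \<otimes>\<^bsub>B1_ring X\<^esub> f \<oplus>\<^bsub>B1_ring X\<^esub> g \<otimes>\<^bsub>B1_ring X\<^esub> g) = zero_set X f \<inter> zero_set X g"
  by (auto simp: zero_set_def)

lemma ideal_sum_squares:
  assumes "ideal J (B1_ring X)" "f \<in> J" "g \<in> J"
  shows "f \<otimes>\<^bsub>B1_ring X\<^esub> f \<oplus>\<^bsub>B1_ring X\<^esub> g \<otimes>\<^bsub>B1_ring X\<^esub> g \<in> J"
proof -
  interpret ideal J "B1_ring X" by fact
  show ?thesis
    by (intro additive_subgroup.a_closed[OF is_additive_subgroup] I_l_closed assms(2,3) Icarr)
qed

lemma ideal_zero_free: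
  assumes "ideal J (B1_ring X)" "f \<in> J" "zero_set X f = {}"
  shows "J = B1 X"
proof -
  interpret ideal J "B1_ring X" by fact
  have f: "f \<in> B1 X"
    using Icarr[OF assms(2)] by simp
  have nz: "f x \<noteq> 0" if "x \<in> topspace X" for x
    using assms(3) that by (auto simp: zero_set_def)
  define g where "g = (\<lambda>x\<in>topspace X. inverse (f x))"
  have "g \<in> carrier (B1_ring X)"
    unfolding g_def using restrict_in_B1[OF baire_one_inverse[OF B1_baire_one[OF f] nz]] by simp
  then have "g \<otimes>\<^bsub>B1_ring X\<^esub> f \<in> J"
    by (rule I_l_closed[OF assms(2)])
  moreover have "g \<otimes>\<^bsub>B1_ring X\<^esub> f = \<one>\<^bsub>B1_ring X\<^esub>"
    using nz by (auto simp: g_def intro: restrict_ext)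
  ultimately show ?thesis
    using one_imp_carrier by simp
qed

section \<open>From filters to ideals\<close>

definition zero_ideal :: "'a topology \<Rightarrow> 'a set set \<Rightarrow> ('a \<Rightarrow> real) set" where
  "zero_ideal X \<F> = {f \<in> B1 X. zero_set X f \<in> \<F>}"

lemma zero_sets_of_zero_ideal:
  "\<F> \<subseteq> B1_zero_sets X \<Longrightarrow> zero_set X ` zero_ideal X \<F> = \<F>"
  by (auto simp: zero_ideal_def B1_zero_sets_def)

lemma ZB_filterD:
  assumes "ZB_filter X \<F>"
  shows "\<F> \<noteq> {}" "\<F> \<subseteq> B1_zero_sets X" "{} \<notin> \<F>"
    and "Z \<in> \<F> \<Longrightarrow> Z' \<in> \<F> \<Longrightarrow> Z \<inter> Z' \<in> \<F>"
    and "Z \<in> \<F> \<Longrightarrow> Z' \<in> B1_zero_sets X \<Longrightarrow> Z \<subseteq> Z' \<Longrightarrow> Z' \<in> \<F>"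
  using assms unfolding ZB_filter_def by blast+

lemma ZB_filter_upward:
  "ZB_filter X \<F> \<Longrightarrow> Z \<in> \<F> \<Longrightarrow> f \<in> B1 X \<Longrightarrow> Z \<subseteq> zero_set X f \<Longrightarrow> zero_set X f \<in> \<F>"
  unfolding ZB_filter_def B1_zero_sets_def by blast

lemma ideal_zero_ideal:
  assumes F: "ZB_filter X \<F>"
  shows "ideal (zero_ideal X \<F>) (B1_ring X)"
proof -
  interpret cring "B1_ring X" by (rule cring_B1_ring)
  have mult: "h \<otimes>\<^bsub>B1_ring X\<^esub> f \<in> zero_ideal X \<F>"
    if "f \<in> zero_ideal X \<F>" "h \<in> B1 X" for f h
  proof -
    have "h \<otimes>\<^bsub>B1_ring X\<^esub> f \<in> B1 X"
      using that m_closed[of h f] by (simp add: zero_ideal_def)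
    moreover have "zero_set X f \<in> \<F>"
      using that by (simp add: zero_ideal_def)
    ultimately show ?thesis
      using ZB_filter_upward[OF F] zero_set_mult[of X h f] unfolding zero_ideal_def by blast
  qed
  have add: "f \<oplus>\<^bsub>B1_ring X\<^esub> g \<in> zero_ideal X \<F>"
    if "f \<in> zero_ideal X \<F>" "g \<in> zero_ideal X \<F>" for f g
  proof -
    have "f \<oplus>\<^bsub>B1_ring X\<^esub> g \<in> B1 X"
      using that a_closed[of f g] by (simp add: zero_ideal_def)
    moreover have "zero_set X f \<inter> zero_set X g \<in> \<F>"
      using that by (intro ZB_filterD(4)[OF F]) (auto simp: zero_ideal_def)
    moreover have "zero_set X f \<inter> zero_set X g \<subseteq> zero_set X (f \<oplus>\<^bsub>B1_ring X\<^esub> g)"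
      by (auto simp: zero_set_def)
    ultimately show ?thesis
      using ZB_filter_upward[OF F] unfolding zero_ideal_def by blast
  qed
  have sub: "zero_ideal X \<F> \<subseteq> carrier (B1_ring X)"
    by (auto simp: zero_ideal_def)
  have "zero_set X ` zero_ideal X \<F> = \<F>" "\<F> \<noteq> {}"
    using zero_sets_of_zero_ideal ZB_filterD[OF F] by blast+
  then have ne: "zero_ideal X \<F> \<noteq> {}"
    by blast
  \<comment> \<open>Negation is multiplication by \<open>-1\<close>, so additive inverses are covered by \<open>mult\<close>.\<close>
  have minus: "\<ominus>\<^bsub>B1_ring X\<^esub> f \<in> zero_ideal X \<F>" if f: "f \<in> zero_ideal X \<F>" for f
  proof -
    have "\<ominus>\<^bsub>B1_ring X\<^esub> f = (\<ominus>\<^bsub>B1_ring X\<^esub> \<one>\<^bsub>B1_ring X\<^esub>) \<otimes>\<^bsub>B1_ring X\<^esub> f"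
      using f sub l_minus[OF one_closed, of f] l_one[of f] by (auto simp del: B1_ring_simps)
    moreover have "\<ominus>\<^bsub>B1_ring X\<^esub> \<one>\<^bsub>B1_ring X\<^esub> \<in> B1 X"
      using a_inv_closed[OF one_closed] by simp
    ultimately show ?thesis
      using mult[OF f] by simp
  qed
  show ?thesis
  proof (rule idealI[OF ring_B1_ring])
    show "subgroup (zero_ideal X \<F>) (add_monoid (B1_ring X))"
      using sub ne minus add by (intro add.subgroupI) (auto simp: a_inv_def)
    fix f h
    assume fh: "f \<in> zero_ideal X \<F>" "h \<in> carrier (B1_ring X)"
    then show "h \<otimes>\<^bsub>B1_ring X\<^esub> f \<in> zero_ideal X \<F>"
      using mult by simp
    then show "f \<otimes>\<^bsub>B1_ring X\<^esub> h \<in> zero_ideal X \<F>"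
      using m_comm[of f h] fh sub by auto
  qed
qed

lemma zero_ideal_proper:
  assumes "ZB_filter X \<F>"
  shows "zero_ideal X \<F> \<noteq> B1 X"
proof
  assume "zero_ideal X \<F> = B1 X"
  then have "(\<lambda>x\<in>topspace X. 1) \<in> zero_ideal X \<F>"
    by (simp add: B1_const)
  then have "zero_set X (\<lambda>x\<in>topspace X. 1) \<in> \<F>"
    by (simp add: zero_ideal_def)
  moreover have "zero_set X (\<lambda>x\<in>topspace X. 1) = {}"
    by (auto simp: zero_set_def)
  ultimately show False
    using ZB_filterD(3)[OF assms] by simp
qed

text \<open>
  If \<open>J\<close> contains some \<open>f\<close> outside the ideal of \<open>\<F>\<close>, the ultrafilter has a member \<open>zero_set X g\<close>
  disjoint from \<open>zero_set X f\<close>; then \<open>f\<^sup>2 + g\<^sup>2\<close> is a unit in \<open>J\<close>.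
\<close>

lemma maximalideal_zero_ideal:
  assumes U: "ZB_ultrafilter X \<F>"
  shows "maximalideal (zero_ideal X \<F>) (B1_ring X)"
proof (rule maximalidealI)
  have F: "ZB_filter X \<F>"
    using U by (simp add: ZB_ultrafilter_def)
  show "ideal (zero_ideal X \<F>) (B1_ring X)"
    by (rule ideal_zero_ideal[OF F])
  show "carrier (B1_ring X) \<noteq> zero_ideal X \<F>"
    using zero_ideal_proper[OF F] by auto
  fix J
  assume J: "ideal J (B1_ring X)" "zero_ideal X \<F> \<subseteq> J" "J \<subseteq> carrier (B1_ring X)"
  show "J = zero_ideal X \<F> \<or> J = carrier (B1_ring X)"
  proof (rule disjCI)
    assume "J \<noteq> carrier (B1_ring X)"
    have "zero_set X f \<in> \<F>" if f: "f \<in> J" for f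
    proof (rule ccontr)
      assume "zero_set X f \<notin> \<F>"
      moreover have "zero_set X f \<in> B1_zero_sets X"
        using f J(3) by (auto simp: B1_zero_sets_def)
      ultimately obtain W where W: "W \<in> \<F>" "W \<inter> zero_set X f = {}"
        using ZB_ultrafilter_meets[OF U] by blast
      moreover have "zero_set X ` zero_ideal X \<F> = \<F>"
        by (intro zero_sets_of_zero_ideal ZB_filterD(2)[OF F])
      ultimately obtain g where g: "g \<in> zero_ideal X \<F>" "W = zero_set X g"
        by blast
      have "zero_set X (g \<otimes>\<^bsub>B1_ring X\<^esub> g \<oplus>\<^bsub>B1_ring X\<^esub> f \<otimes>\<^bsub>B1_ring X\<^esub> f) = {}"
        using W g by (simp only: zero_set_sum_squares)
      then have "J = B1 X"
        using ideal_zero_free[OF J(1) ideal_sum_squares[OF J(1) _ f]] g J(2) by blast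
      then show False
        using \<open>J \<noteq> carrier (B1_ring X)\<close> by simp
    qed
    then show "J = zero_ideal X \<F>"
      using J(2,3) by (auto simp: zero_ideal_def)
  qed
qed

section \<open>From ideals to filters\<close>

lemma ZB_filter_zero_sets_of_ideal:
  assumes I: "ideal I (B1_ring X)" and proper: "I \<noteq> B1 X"
  shows "ZB_filter X (zero_set X ` I)"
proof -
  interpret ideal I "B1_ring X" by fact
  have sub: "I \<subseteq> B1 X"
    using a_subset by simp
  have int: "Z \<inter> Z' \<in> zero_set X ` I"
    if Z: "Z \<in> zero_set X ` I" and Z': "Z' \<in> zero_set X ` I" for Z Z'
  proof -
    obtain f g where fg: "f \<in> I" "g \<in> I" "Z = zero_set X f" "Z' = zero_set X g"
      using Z Z' by blast
    have "zero_set X (f \<otimes>\<^bsub>B1_ring X\<^esub> f \<oplus>\<^bsub>B1_ring X\<^esub> g \<otimes>\<^bsub>B1_ring X\<^esub> g) \<in> zero_set X ` I"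
      by (intro imageI ideal_sum_squares[OF I] fg)
    then show ?thesis
      by (simp only: zero_set_sum_squares fg)
  qed
  have up: "Z' \<in> zero_set X ` I"
    if Z: "Z \<in> zero_set X ` I" and Z': "Z' \<in> B1_zero_sets X" and "Z \<subseteq> Z'" for Z Z'
  proof -
    obtain f g where fg: "f \<in> I" "g \<in> B1 X" "Z = zero_set X f" "Z' = zero_set X g"
      using Z Z' by (auto simp: B1_zero_sets_def)
    have "zero_set X (f \<otimes>\<^bsub>B1_ring X\<^esub> g) \<in> zero_set X ` I"
      using fg by (intro imageI I_r_closed) auto
    moreover have "zero_set X (f \<otimes>\<^bsub>B1_ring X\<^esub> g) = Z'"
      using fg \<open>Z \<subseteq> Z'\<close> by (simp only: zero_set_mult) blast
    ultimately show ?thesis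
      by simp
  qed
  have "{} \<notin> zero_set X ` I"
    using ideal_zero_free[OF I] proper by force
  moreover have "zero_set X ` I \<noteq> {}"
    using additive_subgroup.zero_closed[OF is_additive_subgroup] by blast
  moreover have "zero_set X ` I \<subseteq> B1_zero_sets X"
    using sub by (auto simp: B1_zero_sets_def)
  ultimately show ?thesis
    unfolding ZB_filter_def
    by - (intro conjI ballI impI; (assumption | erule (1) int | erule (2) up))
qed

text \<open>
  A filter \<open>\<G>\<close> above the zero sets of \<open>I\<close> gives a proper ideal above \<open>I\<close>. By maximality that
  ideal is \<open>I\<close>, so \<open>\<G>\<close>, being the family of its zero sets, is no larger.
\<close>

lemma ZB_ultrafilter_zero_sets_of_maximalideal:
  assumes I: "maximalideal I (B1_ring X)"
  shows "ZB_ultrafilter X (zero_set X ` I)" and "zero_ideal X (zero_set X ` I) = I"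
proof -
  interpret maximalideal I "B1_ring X" by fact
  have sub: "I \<subseteq> B1 X"
    using a_subset by simp
  have F: "ZB_filter X (zero_set X ` I)"
    using ZB_filter_zero_sets_of_ideal[OF is_ideal] I_notcarr by auto
  have eq: "zero_ideal X \<G> = I" if G: "ZB_filter X \<G>" "zero_set X ` I \<subseteq> \<G>" for \<G>
  proof -
    have "I \<subseteq> zero_ideal X \<G>" "zero_ideal X \<G> \<subseteq> carrier (B1_ring X)"
      using sub G(2) by (auto simp: zero_ideal_def)
    then show ?thesis
      using I_maximal[OF ideal_zero_ideal[OF G(1)]] zero_ideal_proper[OF G(1)] by simp
  qed
  show "zero_ideal X (zero_set X ` I) = I"
    by (rule eq[OF F order_refl])
  have "\<G> = zero_set X ` I" if G: "ZB_filter X \<G>" "zero_set X ` I \<subseteq> \<G>" for \<G>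
    using zero_sets_of_zero_ideal[OF ZB_filterD(2)[OF G(1)]] eq[OF G] by simp
  with F show "ZB_ultrafilter X (zero_set X ` I)"
    by (simp only: ZB_ultrafilter_def) blast
qed

section \<open>Closures of zero sets in the Stone topology\<close>

text \<open>
  The copy of \<open>Z\<close> meets \<open>ZB_bar Xt U Y\<close> exactly in the points of \<open>Z \<inter> Y\<close>, so a basic closed set
  containing it has \<open>Z \<subseteq> Y\<close>, and every ultrafilter with member \<open>Z\<close> then has member \<open>Y\<close>.
\<close>

lemma stone_closure_of_zero_set:
  assumes idx: "ZB_index X Xt \<iota> U" and Z: "Z \<in> B1_zero_sets X"
  shows "(stone_topology X Xt U) closure_of (\<iota> ` Z) = ZB_bar Xt U Z"
proof (rule closure_of_unique)
  have top: "Z \<subseteq> topspace X"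
    using Z by (auto simp: B1_zero_sets_def zero_set_def)
  have point: "U (\<iota> x) = ZB_point X x" "\<iota> x \<in> Xt" if "x \<in> Z" for x
    using that top idx by (auto simp: ZB_index_def)
  show "\<iota> ` Z \<subseteq> ZB_bar Xt U Z"
    using point Z by (auto simp: ZB_bar_def ZB_point_def)
  show "closedin (stone_topology X Xt U) (ZB_bar Xt U Z)"
    unfolding stone_topology_closedin[OF idx]
    using Z by (intro exI[of _ "{Z}"]) (auto simp: ZB_bar_def)
  fix C
  assume C: "\<iota> ` Z \<subseteq> C" "closedin (stone_topology X Xt U) C"
  obtain \<Z> where \<Z>: "\<Z> \<subseteq> B1_zero_sets X" "C = Xt \<inter> (\<Inter>Y\<in>\<Z>. ZB_bar Xt U Y)"
    using C(2) unfolding stone_topology_closedin[OF idx] by (elim exE conjE) (rule that)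
  have "ZB_bar Xt U Z \<subseteq> ZB_bar Xt U Y" if Y: "Y \<in> \<Z>" for Y
  proof -
    have "Z \<subseteq> Y"
    proof
      fix x
      assume x: "x \<in> Z"
      then have "\<iota> x \<in> ZB_bar Xt U Y"
        using C(1) \<Z>(2) Y by blast
      then show "x \<in> Y"
        using point[OF x] by (simp add: ZB_bar_def ZB_point_def)
    qed
    moreover have "Y \<in> B1_zero_sets X"
      using Y \<Z>(1) by blast
    moreover have "ZB_filter X (U p)" if "p \<in> Xt" for p
      using ZB_index_ultrafilter[OF idx that] by (simp add: ZB_ultrafilter_def)
    ultimately show ?thesis
      unfolding ZB_bar_def using ZB_filterD(5) by blast
  qed
  then show "ZB_bar Xt U Z \<subseteq> C"
    unfolding \<Z>(2) by (auto simp: ZB_bar_def)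
qed

lemma M_hat_eq_zero_ideal:
  assumes "ZB_index X Xt \<iota> U" "p \<in> Xt"
  shows "M_hat X Xt \<iota> U p = zero_ideal X (U p)"
proof -
  have "zero_set X f \<in> B1_zero_sets X" if "f \<in> B1 X" for f
    using that by (simp add: B1_zero_sets_def)
  then show ?thesis
    using stone_closure_of_zero_set[OF assms(1)] assms(2)
    by (auto simp: M_hat_def zero_ideal_def ZB_bar_def)
qed

section \<open>Maximal ideals and ultrafilters\<close>

theorem theorem3p4:
  fixes X :: "'a topology"
    and Xt :: "'b set"
    and \<iota> :: "'a \<Rightarrow> 'b"
    and U :: "'b \<Rightarrow> 'a set set"
  assumes "completely_regular_space X" and "Hausdorff_space X"
    and "ZB_index X Xt \<iota> U"
  shows "{I. maximalideal I (B1_ring X)} = {M_hat X Xt \<iota> U p | p. p \<in> Xt} \<and>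
         (\<forall>p\<in>Xt. \<forall>q\<in>Xt. p \<noteq> q \<longrightarrow> M_hat X Xt \<iota> U p \<noteq> M_hat X Xt \<iota> U q)"
proof (intro conjI ballI impI)
  note idx = assms(3)
  have ultra: "ZB_ultrafilter X (U p)" if "p \<in> Xt" for p
    by (rule ZB_index_ultrafilter[OF idx that])
  show "{I. maximalideal I (B1_ring X)} = {M_hat X Xt \<iota> U p | p. p \<in> Xt}"
  proof (intro equalityI subsetI)
    fix I
    assume "I \<in> {I. maximalideal I (B1_ring X)}"
    then have I: "maximalideal I (B1_ring X)"
      by simp
    then have "zero_set X ` I \<in> U ` Xt"
      using ZB_ultrafilter_zero_sets_of_maximalideal(1) idx
      by (auto simp: ZB_index_def bij_betw_def)
    then obtain p where "p \<in> Xt" "U p = zero_set X ` I"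
      by auto
    then show "I \<in> {M_hat X Xt \<iota> U p | p. p \<in> Xt}"
      using ZB_ultrafilter_zero_sets_of_maximalideal(2)[OF I] M_hat_eq_zero_ideal[OF idx] by force
  next
    fix I
    assume "I \<in> {M_hat X Xt \<iota> U p | p. p \<in> Xt}"
    then obtain p where "p \<in> Xt" "I = M_hat X Xt \<iota> U p"
      by blast
    then show "I \<in> {I. maximalideal I (B1_ring X)}"
      using maximalideal_zero_ideal[OF ultra] M_hat_eq_zero_ideal[OF idx] by simp
  qed
  fix p q
  assume pq: "p \<in> Xt" "q \<in> Xt" "p \<noteq> q"
  have recover: "zero_set X ` M_hat X Xt \<iota> U r = U r" if "r \<in> Xt" for r
    using ultra[OF that] unfolding M_hat_eq_zero_ideal[OF idx that] ZB_ultrafilter_def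
    by (intro zero_sets_of_zero_ideal ZB_filterD(2)) simp
  have "U p \<noteq> U q"
    using pq idx by (auto simp: ZB_index_def bij_betw_def inj_on_def)
  then show "M_hat X Xt \<iota> U p \<noteq> M_hat X Xt \<iota> U q"
    using recover pq by metis
qed

end
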